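(* Let $\alpha=(\alpha_1,\dots,\alpha_k)$ be a peak composition of $n$. The DIRT-generating procedure (described in the context), applied to $\alpha$, generates all dual immaculate recording tableaux of peak shape with row strip shape $\alpha^{\mathrm{rev}}$; that is, the set of fillings containing all of $1,\dots,n$ that it produces is the set of all dual immaculate recording tableaux whose shape is a peak composition and whose row strip shape is $\alpha^{\mathrm{rev}}$.
   Context: Let $n$ be a positive integer, $[n]=\{1,\dots,n\}$. A composition $\alpha=(\alpha_1,\dots,\alpha_k)$ of $n$ is a finite sequence of positive integers summing to $n$; $\alpha^{\mathrm{rev}}=(\alpha_k,\dots,\alpha_1)$. It is a peak composition if all parts except possibly the last are greater than $1$. The diagram $D_\alpha$ is the left-justified array of boxes whose $i$th row from the bottom has $\alpha_i$ boxes; $(c,r)$ denotes the box in column $c$ (leftmost is 1) and row $r$ (bottom is 1). A filling $Q$ of $D_\alpha$ assigns an entry $Q(c,r)$ to each box; $\alpha$ is its shape, and $Q$ has peak shape if $\alpha$ is a peak composition. Dual immaculate recording tableaux: for a filling $Q$ of a composition diagram with entries from $[n]$, each used once, a row strip of length $j$ is a maximal sequence $a_1,\dots,a_j$ of consecutive increasing integers such that for all $1\le i<j$, $a_{i+1}$ is in a column strictly right of that of $a_i$. For a composition $\beta$ of $n$, a filling $Q$ of $D_\beta$ with entries from $[n]$, each used once, is a dual immaculate recording tableau (DIRT) if: (1) entries in each row increase left to right; (2) the row strips start in the first column; (3) entries in the first column increase from top to bottom; (4) if $Q(c,r)>Q(c,r')$ for some $c$ and some $r'<r$, then $Q$ has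 an entry in box $(c+1,r')$ and $Q(c,r)>Q(c+1,r')$. Its row strip shape is the composition $(\gamma_1,\dots,\gamma_k)$ where $\gamma_i$ is the length of the row strip starting with $\gamma_1+\cdots+\gamma_{i-1}+1$. DIRT-generating procedure for a peak composition $\alpha=(\alpha_1,\dots,\alpha_k)$ of $n$: start with the one-row filling with entries $1,2,\dots,\alpha_k$ from left to right (the unique DIRT of peak shape with row strip shape $(\alpha_k)^{\mathrm{rev}}$). For $i=1,2,\dots,k-1$ in turn, perform the following on every filling $Q$ created at the previous step (each being a DIRT of peak shape with row strip shape $(\alpha_{k-i+1},\dots,\alpha_k)^{\mathrm{rev}}$). Let $m$ be the largest entry of $Q$. Assign the entries $m+1,m+2,\dots,m+\alpha_{k-i}$ sequentially to $Q$ in each possible way according to the rules: (1) the entries $m+1$ and $m+2$ become the first two entries of a new bottom row of $Q$ (note $\alpha_{k-i}\ge 2$); (2) each subsequent entry is placed at the end of a row, in a position strictly to the right (i.e. in a strictly greater column) of the last entry placed; (3) no entry can be placed at the end of a row of (current) length $j$ if there exists a row of (current) length $j+1$ below this row. The procedure ends when the entry $n$ has been assigned in each filling; these fillings are the ones generated. *)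

theory Defs
  imports Main "HOL-Library.Sublist"
begin

definition composition :: "nat \<Rightarrow> nat list \<Rightarrow> bool" where
  "composition n \<alpha> \<longleftrightarrow> (\<forall>a\<in>set \<alpha>. 0 < a) \<and> sum_list \<alpha> = n"

definition peak_composition :: "nat \<Rightarrow> nat list \<Rightarrow> bool" where
  "peak_composition n \<alpha> \<longleftrightarrow> composition n \<alpha> \<and> (\<forall>a\<in>set (butlast \<alpha>). 1 < a)"

text \<open>
  A filling of a composition diagram is the list of its rows, from the bottom row to the top row,
  each row being the list of its entries from left to right. Rows and columns are counted from 0
  here: the box called $(c,r)$ with $c, r \geq 1$ in the usual drawing of the diagram has
  the entry \<open>Q ! (r - 1) ! (c - 1)\<close>. A row with smaller index lies below a row with larger index.
\<close>

type_synonym filling = "nat list list"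

definition shape :: "filling \<Rightarrow> nat list" where
  "shape Q = map length Q"

definition entries :: "filling \<Rightarrow> nat set" where
  "entries Q = set (concat Q)"

definition is_box :: "filling \<Rightarrow> nat \<Rightarrow> nat \<Rightarrow> bool" where
  "is_box Q c r \<longleftrightarrow> r < length Q \<and> c < length (Q ! r)"

definition entry :: "filling \<Rightarrow> nat \<Rightarrow> nat \<Rightarrow> nat" where
  "entry Q c r = Q ! r ! c"

text \<open>Only used for entries of fillings without repeated entries.\<close>

definition column :: "filling \<Rightarrow> nat \<Rightarrow> nat" where
  "column Q a = (THE c. \<exists>r. is_box Q c r \<and> entry Q c r = a)"

text \<open>The fillings of composition diagrams of size \<open>n\<close> using each element of $[n]$ once.\<close>

definition standard_filling :: "nat \<Rightarrow> filling \<Rightarrow> bool" where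
  "standard_filling n Q \<longleftrightarrow>
     composition n (shape Q) \<and> distinct (concat Q) \<and> entries Q = {1..n}"

definition row_strip_sequence :: "filling \<Rightarrow> nat list \<Rightarrow> bool" where
  "row_strip_sequence Q s \<longleftrightarrow>
     s \<noteq> [] \<and> set s \<subseteq> entries Q \<and>
     (\<forall>i. Suc i < length s \<longrightarrow>
        s ! Suc i = Suc (s ! i) \<and> column Q (s ! i) < column Q (s ! Suc i))"

text \<open>Maximality is with respect to extension of the sequence at either end.\<close>

definition row_strip :: "filling \<Rightarrow> nat list \<Rightarrow> bool" where
  "row_strip Q s \<longleftrightarrow>
     row_strip_sequence Q s \<and> (\<forall>t. row_strip_sequence Q t \<and> sublist s t \<longrightarrow> t = s)"

definition dirt :: "nat \<Rightarrow> filling \<Rightarrow> bool" where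
  "dirt n Q \<longleftrightarrow>
     standard_filling n Q \<and>
     (\<forall>r c c'. is_box Q c r \<and> is_box Q c' r \<and> c < c' \<longrightarrow> entry Q c r < entry Q c' r) \<and>
     (\<forall>s. row_strip Q s \<longrightarrow> column Q (hd s) = 0) \<and>
     (\<forall>r r'. is_box Q 0 r \<and> is_box Q 0 r' \<and> r' < r \<longrightarrow> entry Q 0 r < entry Q 0 r') \<and>
     (\<forall>c r r'. is_box Q c r \<and> is_box Q c r' \<and> r' < r \<and> entry Q c r > entry Q c r' \<longrightarrow>
        is_box Q (c + 1) r' \<and> entry Q c r > entry Q (c + 1) r')"

definition has_row_strip_shape :: "nat \<Rightarrow> filling \<Rightarrow> nat list \<Rightarrow> bool" where
  "has_row_strip_shape n Q \<gamma> \<longleftrightarrow>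
     composition n \<gamma> \<and>
     (\<forall>i < length \<gamma>. \<exists>s. row_strip Q s \<and> hd s = sum_list (take i \<gamma>) + 1 \<and> length s = \<gamma> ! i)"

text \<open>
  All ways to place the entry \<open>v\<close> at the end of a row when \<open>v - 1\<close> was the last entry placed; the
  new box is in column \<open>length (P ! r)\<close>.
\<close>

definition placements :: "nat \<Rightarrow> filling \<Rightarrow> filling set" where
  "placements v P =
     {P[r := P ! r @ [v]] | r.
        r < length P \<and>
        column P (v - 1) < length (P ! r) \<and>
        \<not> (\<exists>r' < r. length (P ! r') = length (P ! r) + 1)}"

text \<open>All ways to add \<open>a\<close> further entries to \<open>Q\<close>; only meaningful for \<open>a \<ge> 2\<close>.\<close>

definition extensions :: "nat \<Rightarrow> filling \<Rightarrow> filling set" where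
  "extensions a Q =
     (let m = Max (entries Q)
      in foldl (\<lambda>S v. \<Union>P\<in>S. placements v P) {[m + 1, m + 2] # Q} [m + 3..<m + a + 1])"

text \<open>
  The procedure reads the composition from its last part to its first. The value at the empty list
  is a dummy.
\<close>

fun generated :: "nat list \<Rightarrow> filling set" where
  "generated [] = {}"
| "generated [a] = {[[1..<a + 1]]}"
| "generated (a # b # \<alpha>) = (\<Union>Q\<in>generated (b # \<alpha>). extensions a Q)"

end

theory Submission
  imports Defs
begin

text \<open>
  In a filling with increasing rows and a first column decreasing upwards, the largest entry is
  either the last entry of a row or a new bottom row on its own. Removing it preserves the
  conditions on a DIRT other than the one on row strips, and putting it back at the end of a row
  preserves condition (4) exactly when rule (3) of the procedure is respected. Given the row strip
  shape, the condition on row strips says that the entries after the partial sums are in the first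
  column and that every other entry is in a column to the right of its predecessor. Hence the
  procedure reverses the removal of entries. That the second entry of the last row strip has to
  follow the first one in the bottom row is forced by the peak shape: the bottom row needs a second
  entry, and no later entry of this row strip is in column 2.
\<close>

section \<open>Standard fillings and the columns of their entries\<close>

lemma standard_filling_iff:
  "standard_filling n Q \<longleftrightarrow> [] \<notin> set Q \<and> distinct (concat Q) \<and> set (concat Q) = {1..n}"
proof -
  have "sum_list (map length Q) = n" if "distinct (concat Q)" "set (concat Q) = {1..n}"
    using distinct_card[OF that(1)] that(2) by (simp add: length_concat)
  then show ?thesis
    unfolding standard_filling_def composition_def shape_def entries_def by auto
qed

lemma distinct_concat_nth_eq:
  assumes "distinct (concat Q)" "r < length Q" "c < length (Q ! r)"
    "r' < length Q" "c' < length (Q ! r')" "Q ! r ! c = Q ! r' ! c'"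
  shows "r = r' \<and> c = c'"
  using assms
proof (induction Q arbitrary: r r')
  case Nil
  then show ?case by simp
next
  case (Cons q Q)
  have mem: "Q ! k ! c \<in> set (concat Q)" if "k < length Q" "c < length (Q ! k)" for k c
    using that by (metis (no_types, lifting) UN_I nth_mem set_concat)
  have disj: "set q \<inter> set (concat Q) = {}"
    using Cons.prems(1) by simp
  show ?case
  proof (cases r; cases r')
    fix k k' assume "r = Suc k" "r' = Suc k'"
    then show ?thesis using Cons.IH[of k k'] Cons.prems by simp
  next
    fix k assume r: "r = 0" "r' = Suc k"
    then have "q ! c \<in> set (concat Q)" "c < length q"
      using Cons.prems mem[of k c'] by (simp_all del: set_concat)
    then show ?thesis using disj nth_mem by blast
  next
    fix k assume r: "r = Suc k" "r' = 0"
    then have "q ! c' \<in> set (concat Q)" "q ! c' \<in> set q"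
      using Cons.prems mem[of k c] by (auto simp del: set_concat)
    then show ?thesis using disj by blast
  next
    assume "r = 0" "r' = 0"
    then show ?thesis using Cons.prems by (simp add: nth_eq_iff_index_eq)
  qed
qed

text \<open>Distinct entries occupy unique boxes, so the definite description in
  \<open>column\<close> denotes; explicit columns are computed from this.\<close>

lemma column_eq:
  assumes "distinct (concat Q)" "r < length Q" "c < length (Q ! r)"
  shows "column Q (Q ! r ! c) = c"
  unfolding column_def is_box_def entry_def
  using assms distinct_concat_nth_eq[OF assms(1)] by (intro the_equality) blast+

lemma in_entriesE:
  assumes "a \<in> set (concat Q)"
  obtains r c where "r < length Q" "c < length (Q ! r)" "Q ! r ! c = a"
  using assms by (auto simp: in_set_conv_nth)

lemma concat_place:
  assumes "r < length P"
  shows "set (concat (P[r := P ! r @ [x]])) = insert x (set (concat P))"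
    and "distinct (concat (P[r := P ! r @ [x]])) \<longleftrightarrow> x \<notin> set (concat P) \<and> distinct (concat P)"
proof -
  define A B q where "A = take r P" and "B = drop (Suc r) P" and "q = P ! r"
  have P: "P = A @ q # B" and P': "P[r := P ! r @ [x]] = A @ (q @ [x]) # B"
    using assms by (auto simp: A_def B_def q_def id_take_nth_drop upd_conv_take_nth_drop)
  show "set (concat (P[r := P ! r @ [x]])) = insert x (set (concat P))"
    unfolding P' by (subst P) auto
  show "distinct (concat (P[r := P ! r @ [x]])) \<longleftrightarrow> x \<notin> set (concat P) \<and> distinct (concat P)"
    unfolding P' by (subst (1 2) P) auto
qed

text \<open>Needed to carry the row strip condition on the old entries across the placement of a new
  one.\<close>

lemma column_place:
  assumes "r < length P" "distinct (concat P)" "x \<notin> set (concat P)"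
  shows "column (P[r := P ! r @ [x]]) x = length (P ! r)"
    and "a \<in> set (concat P) \<Longrightarrow> column (P[r := P ! r @ [x]]) a = column P a"
proof -
  let ?P = "P[r := P ! r @ [x]]"
  have d: "distinct (concat ?P)"
    using assms concat_place(2)[OF assms(1)] by blast
  show "column ?P x = length (P ! r)"
    using column_eq[OF d, of r "length (P ! r)"] assms(1) by simp
  assume "a \<in> set (concat P)"
  then obtain k c where kc: "k < length P" "c < length (P ! k)" "P ! k ! c = a"
    by (rule in_entriesE)
  then have "c < length (?P ! k)" "?P ! k ! c = a"
    using assms(1) by (auto simp: nth_list_update nth_append)
  then show "column ?P a = column P a"
    using column_eq[OF d, of k c] column_eq[OF assms(2), of k c] kc by simp
qed

lemma column_Cons:
  assumes "distinct (concat (q # P))"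
  shows "c < length q \<Longrightarrow> column (q # P) (q ! c) = c"
    and "a \<in> set (concat P) \<Longrightarrow> column (q # P) a = column P a"
proof -
  show "column (q # P) (q ! c) = c" if "c < length q"
    using column_eq[OF assms, of 0 c] that by simp
  assume "a \<in> set (concat P)"
  then obtain k c where kc: "k < length P" "c < length (P ! k)" "P ! k ! c = a"
    by (rule in_entriesE)
  then show "column (q # P) a = column P a"
    using column_eq[OF assms, of "Suc k" c] column_eq[of P k c] assms by simp
qed

section \<open>Adding and removing the largest entry\<close>

text \<open>\<open>dirt\<close> without the condition on row strips; that one concerns only the
  columns of consecutive entries and is treated separately through \<open>strips\<close>.\<close>

definition predirt :: "nat \<Rightarrow> filling \<Rightarrow> bool" where
  "predirt n Q \<longleftrightarrow>
     standard_filling n Q \<and>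
     (\<forall>r<length Q. sorted_wrt (<) (Q ! r)) \<and>
     (\<forall>r r'. r' < r \<longrightarrow> r < length Q \<longrightarrow> Q ! r ! 0 < Q ! r' ! 0) \<and>
     (\<forall>c r r'. r' < r \<longrightarrow> r < length Q \<longrightarrow> c < length (Q ! r) \<longrightarrow> c < length (Q ! r') \<longrightarrow>
        Q ! r' ! c < Q ! r ! c \<longrightarrow> c + 1 < length (Q ! r') \<and> Q ! r' ! (c + 1) < Q ! r ! c)"

lemma standard_filling_nth:
  assumes "standard_filling n Q" "r < length Q"
  shows "0 < length (Q ! r)"
    and "c < length (Q ! r) \<Longrightarrow> Q ! r ! c \<le> n"
proof -
  show "0 < length (Q ! r)"
    using assms by (metis length_greater_0_conv nth_mem standard_filling_iff)
  assume "c < length (Q ! r)"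
  then have "Q ! r ! c \<in> set (concat Q)"
    using assms(2) by (metis (no_types, lifting) UN_I nth_mem set_concat)
  then show "Q ! r ! c \<le> n"
    using assms by (auto simp: standard_filling_iff simp del: set_concat)
qed

lemma dirt_iff:
  "dirt n Q \<longleftrightarrow> predirt n Q \<and> (\<forall>s. row_strip Q s \<longrightarrow> column Q (hd s) = 0)"
proof (cases "standard_filling n Q")
  case True
  note pos = standard_filling_nth(1)[OF True]
  have 1: "(\<forall>r c c'. is_box Q c r \<and> is_box Q c' r \<and> c < c' \<longrightarrow> entry Q c r < entry Q c' r) \<longleftrightarrow>
      (\<forall>r<length Q. sorted_wrt (<) (Q ! r))"
    unfolding is_box_def entry_def sorted_wrt_iff_nth_less by (meson order_less_trans)
  \<comment> \<open>Rows of a standard filling are nonempty, so every row has a box in column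
    0.\<close>
  have 2: "(\<forall>r r'. is_box Q 0 r \<and> is_box Q 0 r' \<and> r' < r \<longrightarrow> entry Q 0 r < entry Q 0 r') \<longleftrightarrow>
      (\<forall>r r'. r' < r \<longrightarrow> r < length Q \<longrightarrow> Q ! r ! 0 < Q ! r' ! 0)"
    unfolding is_box_def entry_def using pos by (meson order_less_trans)
  have 3: "(\<forall>c r r'. is_box Q c r \<and> is_box Q c r' \<and> r' < r \<and> entry Q c r > entry Q c r' \<longrightarrow>
        is_box Q (c + 1) r' \<and> entry Q c r > entry Q (c + 1) r') \<longleftrightarrow>
      (\<forall>c r r'. r' < r \<longrightarrow> r < length Q \<longrightarrow> c < length (Q ! r) \<longrightarrow> c < length (Q ! r') \<longrightarrow>
        Q ! r' ! c < Q ! r ! c \<longrightarrow> c + 1 < length (Q ! r') \<and> Q ! r' ! (c + 1) < Q ! r ! c)"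
    unfolding is_box_def entry_def by (meson order_less_trans)
  show ?thesis
    unfolding dirt_def predirt_def 1 2 3 using True by blast
qed (simp add: dirt_def predirt_def)

lemma standard_filling_place:
  assumes "r < length P" "P ! r \<noteq> []"
  shows "standard_filling (Suc v) (P[r := P ! r @ [Suc v]]) \<longleftrightarrow> standard_filling v P"
proof -
  have "[] \<in> set (P[r := P ! r @ [Suc v]]) \<longleftrightarrow> [] \<in> set P"
    using assms by (auto simp: in_set_conv_nth nth_list_update)
  moreover have "{1..Suc v} = insert (Suc v) {1..v}" "Suc v \<notin> {1..v}"
    by auto
  ultimately show ?thesis
    unfolding standard_filling_iff concat_place[OF assms(1)] by (metis insert_ident)
qed

lemma standard_filling_Cons:
  "standard_filling (Suc v) ([Suc v] # P) \<longleftrightarrow> standard_filling v P"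
proof -
  have "{1..Suc v} = insert (Suc v) {1..v}" "Suc v \<notin> {1..v}"
    by auto
  moreover have "set (concat ([Suc v] # P)) = insert (Suc v) (set (concat P))"
    "distinct (concat ([Suc v] # P)) \<longleftrightarrow> Suc v \<notin> set (concat P) \<and> distinct (concat P)"
    "[] \<in> set ([Suc v] # P) \<longleftrightarrow> [] \<in> set P"
    by auto
  ultimately show ?thesis
    unfolding standard_filling_iff by (metis insert_ident)
qed

text \<open>\<open>Suc v\<close> exceeds all entries of \<open>P\<close>, so a bottom row consisting
  of it alone respects the order of the first column, and the premise of condition (4) never holds
  with it as the lower row.\<close>

lemma predirt_Cons: "predirt (Suc v) ([Suc v] # P) \<longleftrightarrow> predirt v P"
proof (cases "standard_filling v P")
  case True
  note le = standard_filling_nth[OF True]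
  have 1: "(\<forall>r<length ([Suc v] # P). sorted_wrt (<) (([Suc v] # P) ! r)) \<longleftrightarrow>
      (\<forall>r<length P. sorted_wrt (<) (P ! r))"
    by (simp add: All_less_Suc2)
  have lt: "P ! r ! c < Suc v" if "r < length P" "c < length (P ! r)" for r c
    using le(2)[OF that] by simp
  have 2: "(\<forall>r r'. r' < r \<longrightarrow> r < length ([Suc v] # P) \<longrightarrow>
        ([Suc v] # P) ! r ! 0 < ([Suc v] # P) ! r' ! 0) \<longleftrightarrow>
      (\<forall>r r'. r' < r \<longrightarrow> r < length P \<longrightarrow> P ! r ! 0 < P ! r' ! 0)" (is "?L \<longleftrightarrow> ?R")
  proof
    assume L: ?L
    show ?R
      using L[rule_format, of "Suc _" "Suc _"] by simp
  next
    assume ?R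
    then show ?L
      using lt le(1) by (auto simp: nth_Cons split: nat.split)
  qed
  let ?C = "\<lambda>Q c r r'. r' < r \<longrightarrow> r < length Q \<longrightarrow> c < length (Q ! r) \<longrightarrow> c < length (Q ! r') \<longrightarrow>
        Q ! r' ! c < Q ! r ! c \<longrightarrow> c + 1 < length (Q ! r') \<and> Q ! r' ! (c + 1) < Q ! r ! c"
  have 3: "(\<forall>c r r'. ?C ([Suc v] # P) c r r') \<longleftrightarrow> (\<forall>c r r'. ?C P c r r')" (is "?L \<longleftrightarrow> ?R")
  proof
    assume L: ?L
    show ?R
      using L[rule_format, of "Suc _" "Suc _"] by simp
  next
    assume R: ?R
    show ?L
    proof (intro allI)
      fix c r r'
      show "?C ([Suc v] # P) c r r'"
      proof (cases r)
        case (Suc k)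
        show ?thesis
          using R[rule_format, of "r' - 1" k c] lt[of k c] Suc by (cases r') auto
      qed simp
    qed
  qed
  show ?thesis
    unfolding predirt_def 1 2 3 standard_filling_Cons ..
qed (simp add: predirt_def standard_filling_Cons)

text \<open>The new entry is the largest, so in condition (4) it matters only as the upper entry.
  There it demands that a lower row reaching column \<open>length (P ! r)\<close> also reach the
  next column, where its entry is automatically smaller; this fails exactly for the row lengths
  excluded by rule (3).\<close>

lemma predirt_place:
  assumes r: "r < length P" "P ! r \<noteq> []"
  shows "predirt (Suc v) (P[r := P ! r @ [Suc v]]) \<longleftrightarrow>
    predirt v P \<and> \<not> (\<exists>r'<r. length (P ! r') = length (P ! r) + 1)"
proof (cases "standard_filling v P")
  case True
  let ?P = "P[r := P ! r @ [Suc v]]"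
  have lt: "P ! r ! c < Suc v" if "r < length P" "c < length (P ! r)" for r c
    using standard_filling_nth(2)[OF True that] by simp
  have nth: "?P ! k = (if k = r then P ! r @ [Suc v] else P ! k)" if "k < length P" for k
    using that by (auto simp: nth_list_update)
  have 1: "(\<forall>k<length ?P. sorted_wrt (<) (?P ! k)) \<longleftrightarrow> (\<forall>k<length P. sorted_wrt (<) (P ! k))"
    using lt r by (auto simp: nth sorted_wrt_append in_set_conv_nth)
  have hd: "?P ! k ! 0 = P ! k ! 0" if "k < length P" for k
    using that r by (auto simp: nth nth_append)
  have 2: "(\<forall>k k'. k' < k \<longrightarrow> k < length ?P \<longrightarrow> ?P ! k ! 0 < ?P ! k' ! 0) \<longleftrightarrow>
      (\<forall>k k'. k' < k \<longrightarrow> k < length P \<longrightarrow> P ! k ! 0 < P ! k' ! 0)"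
    by (auto simp: hd)
  let ?C = "\<lambda>Q c r r'. r' < r \<longrightarrow> r < length Q \<longrightarrow> c < length (Q ! r) \<longrightarrow> c < length (Q ! r') \<longrightarrow>
        Q ! r' ! c < Q ! r ! c \<longrightarrow> c + 1 < length (Q ! r') \<and> Q ! r' ! (c + 1) < Q ! r ! c"
  have 3: "(\<forall>c k k'. ?C ?P c k k') \<longleftrightarrow> (\<forall>c k k'. ?C P c k k') \<and>
      \<not> (\<exists>r'<r. length (P ! r') = length (P ! r) + 1)" (is "?L \<longleftrightarrow> ?R \<and> ?N")
  proof (intro iffI conjI)
    assume L: ?L
    show ?R
    proof (intro allI impI)
      fix c k k'
      assume *: "k' < k" "k < length P" "c < length (P ! k)" "c < length (P ! k')"
        "P ! k' ! c < P ! k ! c"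
      then have k': "k' < length P" by simp
      have e: "?P ! k ! c = P ! k ! c" "?P ! k' ! c = P ! k' ! c"
        "c < length (?P ! k)" "c < length (?P ! k')"
        using * k' by (auto simp: nth nth_append)
      have "c + 1 < length (?P ! k') \<and> ?P ! k' ! (c + 1) < P ! k ! c"
        using L[rule_format, of k' k c] * e by simp
      \<comment> \<open>The right neighbour just found has an entry below \<open>P ! k ! c\<close>,
        so it is not the new box and lies in \<open>P\<close> already.\<close>
      moreover have "P ! k ! c < Suc v"
        using lt * by simp
      ultimately show "c + 1 < length (P ! k') \<and> P ! k' ! (c + 1) < P ! k ! c"
        using k' by (auto simp: nth nth_append split: if_splits)
    qed
    show ?N
    proof
      assume "\<exists>r'<r. length (P ! r') = length (P ! r) + 1"
      then obtain r' where r': "r' < r" "length (P ! r') = length (P ! r) + 1" by blast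
      \<comment> \<open>In column \<open>length (P ! r)\<close> row \<open>r\<close> has the new box
        and row \<open>r'\<close> its last box, so the neighbour demanded by (4) is missing.\<close>
      then show False
        using L[rule_format, of r' r "length (P ! r)"] r lt[of r' "length (P ! r)"]
        by (simp add: nth_append)
    qed
  next
    assume "?R \<and> ?N"
    then have R: ?R and N: ?N by blast+
    show ?L
    proof (intro allI impI)
      fix c k k'
      assume *: "k' < k" "k < length ?P" "c < length (?P ! k)" "c < length (?P ! k')"
        "?P ! k' ! c < ?P ! k ! c"
      then have k: "k < length P" and k': "k' < length P" by simp_all
      have new: "?P ! j ! d = Suc v \<and> d = length (P ! j)"
        if "j = r" "d < length (?P ! j)" "\<not> d < length (P ! j)" for j d
        using that r by (auto simp: nth nth_append)
      have old: "?P ! j ! d = P ! j ! d \<and> d < length (?P ! j)"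
        if "j < length P" "d < length (P ! j)" for j d
        using that by (auto simp: nth nth_append)
      have le: "?P ! j ! d \<le> Suc v" if "j < length P" "d < length (?P ! j)" for j d
        using that lt[of j d] by (auto simp: nth nth_append split: if_splits)
      \<comment> \<open>The entry in the lower row is the smaller one here, so it cannot be the
        maximum \<open>Suc v\<close> in the new box.\<close>
      have c': "c < length (P ! k')"
        using *(4,5) le[OF k *(3)] k' by (auto simp: nth nth_append split: if_splits)
      show "c + 1 < length (?P ! k') \<and> ?P ! k' ! (c + 1) < ?P ! k ! c"
      proof (cases "c < length (P ! k)")
        case True
        then show ?thesis
          using R[rule_format, of k' k c] *(1,5) k c' old[of k c] old[of k' c] old[of k' "c + 1"] k'
          by simp
      next
        case False
        then have kr: "k = r" "c = length (P ! r)"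
          using *(3) k by (auto simp: nth split: if_splits)
        \<comment> \<open>Row \<open>k'\<close> reaches column \<open>c\<close>, and rule (3)
          excludes that it ends there.\<close>
        then have "c + 1 < length (P ! k')"
          using N *(1) c' by (metis Suc_eq_plus1 Suc_lessI)
        then show ?thesis
          using old[of k' "c + 1"] k' lt[of k' "c + 1"] kr r by (simp add: nth)
      qed
    qed
  qed
  show ?thesis
    unfolding predirt_def 1 2 3 standard_filling_place[OF r] by blast
qed (simp add: predirt_def standard_filling_place[OF r])

text \<open>The backward step of the procedure, undoing the assignment of one entry; it inverts
  \<open>predirt_Cons\<close> and \<open>predirt_place\<close>.\<close>

lemma predirt_cases:
  assumes "predirt (Suc v) Q"
  obtains (new_row) P where "Q = [Suc v] # P" "predirt v P"
  | (place) P r where "r < length P" "P ! r \<noteq> []" "Q = P[r := P ! r @ [Suc v]]" "predirt v P"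
      "\<not> (\<exists>r'<r. length (P ! r') = length (P ! r) + 1)"
proof -
  have sf: "standard_filling (Suc v) Q"
    using assms by (simp add: predirt_def)
  then have "Suc v \<in> set (concat Q)"
    by (auto simp: standard_filling_iff simp del: set_concat)
  then obtain r c where rc: "r < length Q" "c < length (Q ! r)" "Q ! r ! c = Suc v"
    by (rule in_entriesE)
  have "\<not> Suc c < length (Q ! r)"
  proof
    assume c: "Suc c < length (Q ! r)"
    have "Q ! r ! c < Q ! r ! Suc c"
      using assms rc(1) c by (auto simp: predirt_def sorted_wrt_iff_nth_less)
    then show False
      using standard_filling_nth(2)[OF sf rc(1) c] rc(3) by simp
  qed
  then have c: "length (Q ! r) = Suc c"
    using rc(2) by simp
  define q where "q = butlast (Q ! r)"
  have q: "Q ! r = q @ [Suc v]"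
    using rc c unfolding q_def
    by (metis append_butlast_last_id diff_Suc_1 last_conv_nth length_0_conv nat.distinct(1))
  show ?thesis
  proof (cases "q = []")
    case True
    \<comment> \<open>Otherwise the first entry of the bottom row would exceed the maximum
      \<open>Suc v\<close>.\<close>
    have "r = 0"
    proof (rule ccontr)
      assume "r \<noteq> 0"
      then have "Suc v < Q ! 0 ! 0"
        using assms rc(1) q True unfolding predirt_def by (metis append_Nil gr0I nth_Cons_0)
      then show False
        using standard_filling_nth(2)[OF sf, of 0 0] standard_filling_nth(1)[OF sf, of 0] rc(1) by force
    qed
    then have "Q = [Suc v] # tl Q"
      using q True rc(1) by (cases Q) auto
    then show ?thesis
      using new_row[of "tl Q"] predirt_Cons[of v "tl Q"] assms by simp
  next
    case False
    let ?P = "Q[r := q]"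
    have "r < length ?P" "?P ! r \<noteq> []" "Q = ?P[r := ?P ! r @ [Suc v]]"
      using rc(1) q False by (auto simp flip: q)
    then show ?thesis
      using place[of r ?P] predirt_place[of r ?P v] assms by metis
  qed
qed


section \<open>Row strip shape as a condition on the columns of consecutive entries\<close>

text \<open>
  Here \<open>f\<close> stands for \<open>column Q\<close>. The condition is local, in contrast to the maximality in
  \<open>row_strip\<close>, so that it can be followed one entry at a time.
\<close>

definition strips :: "(nat \<Rightarrow> nat) \<Rightarrow> nat list \<Rightarrow> bool" where
  "strips f \<gamma> \<longleftrightarrow>
     (\<forall>i<length \<gamma>. f (Suc (sum_list (take i \<gamma>))) = 0 \<and>
        (\<forall>j. 0 < j \<and> j < \<gamma> ! i \<longrightarrow> f (sum_list (take i \<gamma>) + j) < f (Suc (sum_list (take i \<gamma>) + j))))"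

lemma strips_Nil: "strips f []"
  by (simp add: strips_def)

lemma strips_snoc:
  "strips f (\<gamma> @ [a]) \<longleftrightarrow> strips f \<gamma> \<and> f (Suc (sum_list \<gamma>)) = 0 \<and>
     (\<forall>j. 0 < j \<and> j < a \<longrightarrow> f (sum_list \<gamma> + j) < f (Suc (sum_list \<gamma> + j)))"
  unfolding strips_def by (simp add: less_Suc_eq all_conj_distrib imp_conjR nth_append
      disj_imp cong: conj_cong) (auto simp: nth_append)

text \<open>Lengthening the last strip by one entry adds a single comparison, which is rule (2) of
  the procedure. For \<open>a = 0\<close> the entry would start a strip instead.\<close>

lemma strips_snoc_Suc:
  assumes "0 < a"
  shows "strips f (\<gamma> @ [Suc a]) \<longleftrightarrow>
    strips f (\<gamma> @ [a]) \<and> f (sum_list \<gamma> + a) < f (Suc (sum_list \<gamma> + a))"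
  using assms by (auto simp: strips_snoc less_Suc_eq)

lemma sum_list_take_le: "sum_list (take (Suc i) \<gamma>) \<le> sum_list (\<gamma> :: nat list)"
  by (metis append_take_drop_id le_add1 sum_list_append)

lemma sum_list_take_Suc: "i < length \<gamma> \<Longrightarrow> sum_list (take (Suc i) \<gamma>) = sum_list (take i \<gamma>) + \<gamma> ! i"
  for \<gamma> :: "nat list"
  by (simp add: take_Suc_conv_app_nth)

text \<open>With positive parts, \<open>strips\<close> evaluates its function only on
  \<open>{1..sum_list \<gamma>}\<close>; a final part 0 would involve the next entry too.\<close>

lemma strips_cong:
  assumes "\<And>a. 0 < a \<Longrightarrow> a \<le> sum_list \<gamma> \<Longrightarrow> f a = g a" "\<forall>a\<in>set \<gamma>. 0 < a"
  shows "strips f \<gamma> \<longleftrightarrow> strips g \<gamma>"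
  using assms
proof (induction \<gamma> rule: rev_induct)
  case (snoc a \<gamma>)
  then show ?case by (simp add: strips_snoc)
qed (simp add: strips_Nil)

text \<open>Locates \<open>a\<close> in the block of its row strip; the offset \<open>j\<close>
  counts from 0, so \<open>j = 0\<close> is the start of the block.\<close>

lemma sum_list_take_cases:
  assumes "0 < a" "a \<le> sum_list \<gamma>"
  obtains i j where "i < length \<gamma>" "j < \<gamma> ! i" "a = Suc (sum_list (take i \<gamma>) + j)"
  using assms(2)
proof (induction \<gamma> arbitrary: thesis rule: rev_induct)
  case Nil
  then show ?case using assms(1) by simp
next
  case (snoc b \<gamma>)
  show ?case
  proof (cases "a \<le> sum_list \<gamma>")
    case True
    obtain i j where "i < length \<gamma>" "j < \<gamma> ! i" "a = Suc (sum_list (take i \<gamma>) + j)"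
      using snoc.IH[OF _ True] .
    then show ?thesis
      using snoc.prems(1)[of i j] by (simp add: nth_append)
  next
    case False
    then show ?thesis
      using snoc.prems(2) snoc.prems(1)[of "length \<gamma>" "a - Suc (sum_list \<gamma>)"] by simp
  qed
qed

lemma row_strip_sequence_nth:
  assumes "row_strip_sequence Q s" "i < length s"
  shows "s ! i = hd s + i"
  using assms(2)
proof (induction i)
  case 0
  then show ?case by (simp add: hd_conv_nth)
next
  case (Suc i)
  then show ?case using assms(1) by (simp add: row_strip_sequence_def)
qed

lemma row_strip_sequence_Cons:
  assumes "row_strip_sequence Q s" "a \<in> entries Q" "hd s = Suc a" "column Q a < column Q (Suc a)"
  shows "row_strip_sequence Q (a # s)"
  using assms unfolding row_strip_sequence_def
  by (auto simp: nth_Cons hd_conv_nth split: nat.split)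

text \<open>Each block is maximal: its first entry is in the first column, so nothing can precede
  it, and the entry after it is either beyond \<open>n\<close> or the start of another block, again
  in the first column.\<close>

lemma row_strip_upt:
  assumes Q: "entries Q = {1..n}" and "\<forall>a\<in>set \<gamma>. 0 < a" "sum_list \<gamma> = n"
    and \<gamma>: "strips (column Q) \<gamma>" and i: "i < length \<gamma>"
  shows "row_strip Q [Suc (sum_list (take i \<gamma>))..<Suc (sum_list (take (Suc i) \<gamma>))]"
proof -
  define m m' where "m = sum_list (take i \<gamma>)" and "m' = sum_list (take (Suc i) \<gamma>)"
  have m': "m' = m + \<gamma> ! i" "m' \<le> n" "m < m'"
    using sum_list_take_Suc[OF i] sum_list_take_le[of i \<gamma>] assms(2,3) i by (auto simp: m_def m'_def)
  let ?s = "[Suc m..<Suc m']"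
  have step: "column Q (m + j) < column Q (Suc (m + j))" if "0 < j" "m + j < m'" for j
    using \<gamma> i that m'(1) by (simp add: strips_def m_def)
  have s: "row_strip_sequence Q ?s"
    unfolding row_strip_sequence_def using Q m' step[of "Suc _"] by (auto simp: nth_append simp del: upt_Suc)
  have "t = ?s" if t: "row_strip_sequence Q t" and sub: "sublist ?s t" for t
  proof -
    obtain p q where t_eq: "t = p @ ?s @ q"
      using sub by (auto simp: sublist_def)
    have nth: "t ! Suc k = Suc (t ! k) \<and> column Q (t ! k) < column Q (t ! Suc k)"
      if "Suc k < length t" for k
      using t that unfolding row_strip_sequence_def by blast
    have first: "t ! length p = Suc m" and last: "t ! (length p + (m' - m) - 1) = m'"
      using m'(3) by (auto simp: t_eq nth_append simp del: upt_Suc)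
    have "p = []"
    proof (rule ccontr)
      assume "p \<noteq> []"
      then have "Suc (length p - 1) = length p" "length p < length t"
        using m'(3) by (simp_all add: t_eq del: upt_Suc)
      \<comment> \<open>The element of \<open>t\<close> before the block would lie left of the first
        column.\<close>
      then have "column Q (t ! (length p - 1)) < column Q (Suc m)"
        using nth[of "length p - 1"] first by metis
      then show False
        using \<gamma> i by (simp add: strips_def m_def)
    qed
    moreover have "q = []"
    proof (rule ccontr)
      assume "q \<noteq> []"
      then have l: "length p + (m' - m) < length t"
        by (simp add: t_eq del: upt_Suc)
      have end_ix: "Suc (length p + (m' - m) - 1) = length p + (m' - m)"
        using m'(3) by simp
      have q: "t ! (length p + (m' - m)) = Suc m'" "column Q m' < column Q (Suc m')"
        using nth[of "length p + (m' - m) - 1"] last end_ix l by metis+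
      then have "Suc m' \<in> entries Q"
        using t l nth_mem unfolding row_strip_sequence_def by (metis subsetD)
      then have "m' < n"
        using Q by simp
      then have "Suc i < length \<gamma>"
        using assms(3) by (metis i m'_def Suc_lessI less_irrefl take_all order_refl)
      then have "column Q (Suc m') = 0"
        using \<gamma> by (simp add: strips_def m'_def)
      then show False using q(2) by simp
    qed
    ultimately show ?thesis using t_eq by simp
  qed
  then show ?thesis
    using s unfolding row_strip_def m_def m'_def by blast
qed

text \<open>In one direction, consecutive members of the given strips are compared. Conversely, the
  blocks are row strips by \<open>row_strip_upt\<close>, and a row strip whose head is not the start
  of a block could be extended by the preceding entry of that block.\<close>

lemma strips_iff_has_row_strip_shape:
  assumes Q: "standard_filling n Q"
  shows "(\<forall>s. row_strip Q s \<longrightarrow> column Q (hd s) = 0) \<and> has_row_strip_shape n Q \<gamma> \<longleftrightarrow>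
    composition n \<gamma> \<and> strips (column Q) \<gamma>"
proof (intro iffI; elim conjE)
  assume col: "\<forall>s. row_strip Q s \<longrightarrow> column Q (hd s) = 0" and sh: "has_row_strip_shape n Q \<gamma>"
  have "column Q (Suc (sum_list (take i \<gamma>))) = 0 \<and>
      (\<forall>j. 0 < j \<and> j < \<gamma> ! i \<longrightarrow>
        column Q (sum_list (take i \<gamma>) + j) < column Q (Suc (sum_list (take i \<gamma>) + j)))"
    if i: "i < length \<gamma>" for i
  proof -
    obtain s where s: "row_strip Q s" "hd s = sum_list (take i \<gamma>) + 1" "length s = \<gamma> ! i"
      using sh i unfolding has_row_strip_shape_def by blast
    then have seq: "row_strip_sequence Q s"
      by (simp add: row_strip_def)
    have "column Q (sum_list (take i \<gamma>) + j) < column Q (Suc (sum_list (take i \<gamma>) + j))"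
      if "0 < j" "j < \<gamma> ! i" for j
      using seq that s(2,3) row_strip_sequence_nth[OF seq, of "j - 1"]
        row_strip_sequence_nth[OF seq, of j]
      unfolding row_strip_sequence_def by (cases j) auto
    then show ?thesis
      using col s(1,2) by fastforce
  qed
  then show "composition n \<gamma> \<and> strips (column Q) \<gamma>"
    using sh by (simp add: has_row_strip_shape_def strips_def)
next
  assume comp: "composition n \<gamma>" and st: "strips (column Q) \<gamma>"
  have ent: "entries Q = {1..n}"
    using Q by (simp add: standard_filling_def)
  have pos: "\<forall>a\<in>set \<gamma>. 0 < a" and sum: "sum_list \<gamma> = n"
    using comp by (auto simp: composition_def)
  have "\<exists>s. row_strip Q s \<and> hd s = sum_list (take i \<gamma>) + 1 \<and> length s = \<gamma> ! i"
    if i: "i < length \<gamma>" for i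
    using row_strip_upt[OF ent pos sum st i] pos i sum_list_take_Suc[OF i]
    by (intro exI[of _ "[Suc (sum_list (take i \<gamma>))..<Suc (sum_list (take (Suc i) \<gamma>))]"])
      (auto simp del: upt_Suc)
  moreover have "column Q (hd s) = 0" if s: "row_strip Q s" for s
  proof (rule ccontr)
    assume nz: "column Q (hd s) \<noteq> 0"
    have seq: "row_strip_sequence Q s"
      using s by (simp add: row_strip_def)
    then have "hd s \<in> entries Q"
      by (auto simp: row_strip_sequence_def)
    then have hd: "0 < hd s" "hd s \<le> sum_list \<gamma>"
      using ent sum by auto
    obtain i j where ij: "i < length \<gamma>" "j < \<gamma> ! i" "hd s = Suc (sum_list (take i \<gamma>) + j)"
      using sum_list_take_cases[OF hd] .
    \<comment> \<open>Offset 0 would put the head in the first column.\<close>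
    have "0 < j"
      using st ij nz by (cases j) (auto simp: strips_def)
    then have "row_strip_sequence Q ((sum_list (take i \<gamma>) + j) # s)"
      using st ij ent hd sum by (intro row_strip_sequence_Cons[OF seq]) (auto simp: strips_def)
    moreover have "sublist s ((sum_list (take i \<gamma>) + j) # s)"
      by (simp add: sublist_Cons_right)
    ultimately have "(sum_list (take i \<gamma>) + j) # s = s"
      using s unfolding row_strip_def by blast
    then show False by simp
  qed
  ultimately show "(\<forall>s. row_strip Q s \<longrightarrow> column Q (hd s) = 0) \<and> has_row_strip_shape n Q \<gamma>"
    using comp by (simp add: has_row_strip_shape_def)
qed

section \<open>Recording tableaux of peak shape and single steps of the procedure\<close>

text \<open>The right-hand side of the theorem in a form suited to induction on the entries: the
  size is read off \<open>\<gamma>\<close>, and the row exempt from the length bound is the top one,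
  last in the list.\<close>

definition peak_dirts :: "nat list \<Rightarrow> filling set" where
  "peak_dirts \<gamma> = {Q. predirt (sum_list \<gamma>) Q \<and> strips (column Q) \<gamma> \<and>
     (\<forall>i. Suc i < length Q \<longrightarrow> 1 < length (Q ! i))}"

lemma peak_dirts_eq:
  assumes "composition n \<gamma>"
  shows "peak_dirts \<gamma> = {Q. dirt n Q \<and> peak_composition n (shape Q) \<and> has_row_strip_shape n Q \<gamma>}"
proof -
  have "(\<forall>i. Suc i < length Q \<longrightarrow> 1 < length (Q ! i)) \<longleftrightarrow> (\<forall>a\<in>set (butlast (shape Q)). 1 < a)"
    for Q :: filling
    by (auto simp: shape_def all_set_conv_all_nth nth_butlast less_diff_conv)
  moreover have "sum_list \<gamma> = n"
    using assms by (simp add: composition_def)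
  moreover have "predirt n Q \<and> strips (column Q) \<gamma> \<longleftrightarrow> dirt n Q \<and> has_row_strip_shape n Q \<gamma>" for Q
    using assms strips_iff_has_row_strip_shape[of n Q \<gamma>] unfolding dirt_iff predirt_def by blast
  moreover have "composition n (shape Q)" if "dirt n Q" for Q
    using that by (simp add: dirt_def standard_filling_def)
  ultimately show ?thesis
    unfolding peak_dirts_def peak_composition_def by blast
qed

text \<open>In a single strip every entry except 1 lies right of its predecessor, so only 1 can
  begin a row and there is just one row.\<close>

lemma peak_dirts_singleton:
  assumes "0 < a"
  shows "peak_dirts [a] = {[[1..<a + 1]]}"
proof (intro equalityI subsetI)
  fix Q assume "Q \<in> peak_dirts [a]"
  then have Q: "predirt a Q" and st: "strips (column Q) ([] @ [a])"
    by (simp_all add: peak_dirts_def)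
  then have sf: "standard_filling a Q" by (simp add: predirt_def)
  then have d: "distinct (concat Q)" and set: "set (concat Q) = {1..a}"
    by (simp_all add: standard_filling_iff del: set_concat)
  have one: "Q ! r ! 0 = 1" if r: "r < length Q" for r
  proof -
    have l: "0 < length (Q ! r)"
      using standard_filling_nth(1)[OF sf r] .
    then have "Q ! r ! 0 \<in> set (concat Q)"
      using r by (metis (no_types, lifting) UN_I nth_mem set_concat)
    then have *: "0 < Q ! r ! 0" "Q ! r ! 0 \<le> a" unfolding set by auto
    moreover have "column Q (Q ! r ! 0) = 0"
      using column_eq[OF d r l] .
    \<comment> \<open>An entry \<open>x > 1\<close> in the first column would have
      \<open>x - 1\<close> in a column further left; hence the instance
      \<open>Q ! r ! 0 - 1\<close>.\<close>
    ultimately show ?thesis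
      using st[unfolded strips_snoc, THEN conjunct2, THEN conjunct2, rule_format, of "Q ! r ! 0 - 1"]
      by (cases "Q ! r ! 0 = 1") (simp, fastforce)
  qed
  have "Q \<noteq> []"
    using set assms by auto
  moreover have "\<not> 1 < length Q"
  proof
    assume "1 < length Q"
    then have "Q ! 1 ! 0 < Q ! 0 ! 0"
      using Q by (auto simp: predirt_def)
    moreover have "Q ! 0 ! 0 = 1" "Q ! 1 ! 0 = 1"
      using \<open>1 < length Q\<close> by (auto intro!: one[unfolded One_nat_def])
    ultimately show False by simp
  qed
  ultimately obtain q where q: "Q = [q]"
    by (metis One_nat_def Suc_lessI length_0_conv length_Suc_conv length_greater_0_conv)
  have "sorted_wrt (<) q"
    using Q q by (auto simp: predirt_def)
  moreover have "set q = {1..a}" using set q by simp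
  ultimately have "q = [1..<a + 1]"
    by - (rule strict_sorted_equal,
      simp_all add: atLeastLessThanSuc_atLeastAtMost del: upt_Suc)
  then show "Q \<in> {[[1..<a + 1]]}" using q by simp
next
  fix Q assume "Q \<in> {[[1..<a + 1]]}"
  then have Q: "Q = [[1..<a + 1]]" by simp
  have "standard_filling a Q"
    using assms by (auto simp: standard_filling_iff Q)
  then have "predirt a Q"
    by (auto simp: predirt_def Q simp del: upt_Suc)
  moreover have "column Q (Suc j) = j" if "j < a" for j
    using column_eq[of Q 0 j] that by (simp add: Q del: upt_Suc)
  note col = this
  have "column Q j < column Q (Suc j)" if "0 < j" "j < a" for j
    using col[of j] col[of "j - 1"] that by simp
  then have "strips (column Q) ([] @ [a])"
    unfolding strips_snoc using col[of 0] assms by (simp add: strips_Nil)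
  ultimately show "Q \<in> peak_dirts [a]"
    by (simp add: peak_dirts_def Q)
qed

text \<open>Both entries are added at once, since after the first alone a bottom row of length 1
  lies below other rows, which is no peak shape. \<open>\<gamma> \<noteq> []\<close> provides those
  other rows.\<close>

lemma peak_dirts_new_row:
  assumes pos: "\<forall>a\<in>set \<gamma>. 0 < a" and "\<gamma> \<noteq> []"
  shows "peak_dirts (\<gamma> @ [2]) = (\<lambda>Q. [sum_list \<gamma> + 1, sum_list \<gamma> + 2] # Q) ` peak_dirts \<gamma>"
proof -
  define m where "m = sum_list \<gamma>"
  have m: "0 < m"
    using assms by (cases \<gamma>) (auto simp: m_def)
  have st2: "strips f (\<gamma> @ [2]) \<longleftrightarrow> strips f \<gamma> \<and> f (Suc m) = 0 \<and> f (Suc m) < f (Suc (Suc m))" for f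
    using strips_snoc_Suc[of 1 f \<gamma>] strips_snoc[of f \<gamma> 1] by (auto simp: m_def numeral_2_eq_2)
  \<comment> \<open>No row lies below the bottom one, so rule (3) does not restrict the placement of
    the second entry.\<close>
  have pd: "predirt (Suc (Suc m)) ([Suc m, Suc (Suc m)] # Q) \<longleftrightarrow> predirt m Q" for Q
    using predirt_place[of 0 "[Suc m] # Q" "Suc m"] by (simp add: predirt_Cons)
  have col: "column ([Suc m, Suc (Suc m)] # Q) (Suc m) = 0"
      "column ([Suc m, Suc (Suc m)] # Q) (Suc (Suc m)) = 1"
      "strips (column ([Suc m, Suc (Suc m)] # Q)) \<gamma> \<longleftrightarrow> strips (column Q) \<gamma>"
    if "predirt m Q" for Q
  proof -
    have "standard_filling (Suc (Suc m)) ([Suc m, Suc (Suc m)] # Q)"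
      using that pd[of Q] unfolding predirt_def by blast
    then have d: "distinct (concat ([Suc m, Suc (Suc m)] # Q))"
      by (simp add: standard_filling_iff)
    have "set (concat Q) = {1..m}"
      using that by (simp add: predirt_def standard_filling_iff)
    then show "strips (column ([Suc m, Suc (Suc m)] # Q)) \<gamma> \<longleftrightarrow> strips (column Q) \<gamma>"
      using column_Cons(2)[OF d] pos by (intro strips_cong) (auto simp: m_def simp del: set_concat)
    show "column ([Suc m, Suc (Suc m)] # Q) (Suc m) = 0"
      "column ([Suc m, Suc (Suc m)] # Q) (Suc (Suc m)) = 1"
      using column_Cons(1)[OF d, of 0] column_Cons(1)[OF d, of 1] by simp_all
  qed
  have mem: "[Suc m, Suc (Suc m)] # Q \<in> peak_dirts (\<gamma> @ [2]) \<longleftrightarrow> Q \<in> peak_dirts \<gamma>" for Q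
  proof -
    have "(\<forall>i. Suc i < length ([Suc m, Suc (Suc m)] # Q) \<longrightarrow> 1 < length (([Suc m, Suc (Suc m)] # Q) ! i)) \<longleftrightarrow>
       (\<forall>i. Suc i < length Q \<longrightarrow> 1 < length (Q ! i))"
      by (auto simp: nth_Cons split: nat.split)
    then show ?thesis
      unfolding peak_dirts_def using col[of Q] pd[of Q] by (auto simp: st2 m_def)
  qed
  have "P \<in> (\<lambda>Q. [Suc m, Suc (Suc m)] # Q) ` peak_dirts \<gamma>" if P: "P \<in> peak_dirts (\<gamma> @ [2])" for P
  proof -
    have pP: "predirt (Suc (Suc m)) P" and sP: "column P (Suc m) = 0" "0 < column P (Suc (Suc m))"
      and kP: "\<And>i. Suc i < length P \<Longrightarrow> 1 < length (P ! i)"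
      using P by (auto simp: peak_dirts_def st2 m_def)
    have dP: "distinct (concat P)"
      using pP by (simp add: predirt_def standard_filling_iff)
    from pP show ?thesis
    proof (cases rule: predirt_cases)
      case (new_row R)
      \<comment> \<open>As a row of its own, \<open>Suc (Suc m)\<close> would be in the first
        column, against \<open>sP\<close>.\<close>
      then show ?thesis
        using sP(2) column_eq[OF dP, of 0 0] by simp
    next
      case (place R r)
      have dR: "distinct (concat R)" "set (concat R) = {1..Suc m}"
        using place(4) by (simp_all add: predirt_def standard_filling_iff)
      then have cR: "column R (Suc m) = 0"
        using column_place(2)[of r R "Suc (Suc m)" "Suc m"] place(1,3) sP(1) by (simp del: set_concat)
      from place(4) show ?thesis
      proof (cases rule: predirt_cases)
        case (new_row Q)
        have "Q \<noteq> []"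
          using new_row(2) m by (auto simp: predirt_def standard_filling_iff)
        \<comment> \<open>The bottom row \<open>[Suc m]\<close> is not the top row, so it needs a
          second box, and only \<open>Suc (Suc m)\<close> is left to fill it.\<close>
        then have "r = 0"
          using kP[of 0] place(1,3) new_row(1) by (cases r) auto
        then have "P = [Suc m, Suc (Suc m)] # Q"
          using place(3) new_row(1) by simp
        then show ?thesis using P mem by blast
      next
        case (place S k)
        have "distinct (concat S)" "set (concat S) = {1..m}"
          using place(4) by (simp_all add: predirt_def standard_filling_iff)
        \<comment> \<open>Appended to a nonempty row, \<open>Suc m\<close> would not be in the first
          column.\<close>
        then show ?thesis
          using column_place(1)[of k S "Suc m"] place(1-3) cR by (simp del: set_concat)
      qed
    qed
  qed
  then show ?thesis
    using mem by (auto simp: m_def)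
qed

text \<open>Rule (2) is the comparison added by \<open>strips_snoc_Suc\<close>, and rule (3) comes
  from \<open>predirt_place\<close>. The peak shape is unaffected: the last entry placed is outside
  the first column, so a row ending strictly right of it has at least two boxes already.\<close>

lemma peak_dirts_place:
  assumes pos: "\<forall>a\<in>set \<gamma>. 0 < a" and a: "2 \<le> a"
  shows "peak_dirts (\<gamma> @ [Suc a]) = (\<Union>P\<in>peak_dirts (\<gamma> @ [a]). placements (sum_list \<gamma> + Suc a) P)"
proof -
  define v where "v = sum_list \<gamma> + a"
  have st: "strips f (\<gamma> @ [Suc a]) \<longleftrightarrow> strips f (\<gamma> @ [a]) \<and> f v < f (Suc v)" for f
    using strips_snoc_Suc[of a f \<gamma>] a by (simp add: v_def)
  \<comment> \<open>The bound \<open>2 \<le> a\<close> enters here: \<open>v\<close> has a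
    predecessor in its strip.\<close>
  have big: "0 < f v" if "strips f (\<gamma> @ [a])" for f
  proof -
    have "f (sum_list \<gamma> + (a - 1)) < f (Suc (sum_list \<gamma> + (a - 1)))"
      using that[unfolded strips_snoc, THEN conjunct2, THEN conjunct2, rule_format, of "a - 1"] a
      by simp
    moreover have "Suc (sum_list \<gamma> + (a - 1)) = v"
      using a by (simp add: v_def)
    ultimately show ?thesis by simp
  qed
  have key: "P[r := P ! r @ [Suc v]] \<in> peak_dirts (\<gamma> @ [Suc a]) \<longleftrightarrow>
      P \<in> peak_dirts (\<gamma> @ [a]) \<and> column P v < length (P ! r) \<and>
      \<not> (\<exists>r'<r. length (P ! r') = length (P ! r) + 1)"
    if r: "r < length P" "P ! r \<noteq> []" "predirt v P" for P r
  proof -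
    let ?P = "P[r := P ! r @ [Suc v]]"
    have d: "distinct (concat P)" and set: "set (concat P) = {1..v}"
      using r(3) by (simp_all add: predirt_def standard_filling_iff)
    have x: "Suc v \<notin> set (concat P)"
      unfolding set by simp
    note col = column_place[OF r(1) d x]
    have v: "column ?P v = column P v"
      using col(2)[of v] set a by (simp add: v_def del: set_concat)
    have s: "strips (column ?P) (\<gamma> @ [a]) \<longleftrightarrow> strips (column P) (\<gamma> @ [a])"
      using pos a col(2) set by (intro strips_cong) (auto simp: v_def simp del: set_concat)
    have peak: "(\<forall>i. Suc i < length ?P \<longrightarrow> 1 < length (?P ! i)) \<longleftrightarrow>
        (\<forall>i. Suc i < length P \<longrightarrow> 1 < length (P ! i))" if "1 < length (P ! r)"
      using that r(1) by (auto simp: nth_list_update)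
    have sum: "sum_list (\<gamma> @ [Suc a]) = Suc v" "sum_list (\<gamma> @ [a]) = v"
      by (simp_all add: v_def)
    show ?thesis
      unfolding peak_dirts_def mem_Collect_eq st s v col(1) sum predirt_place[OF r(1,2)]
      using big[of "column P"] peak by fastforce
  qed
  show ?thesis
  proof (intro equalityI subsetI)
    fix Q assume Q: "Q \<in> peak_dirts (\<gamma> @ [Suc a])"
    then have pQ: "predirt (Suc v) Q" and sQ: "strips (column Q) (\<gamma> @ [Suc a])"
      by (simp_all add: peak_dirts_def v_def)
    from pQ show "Q \<in> (\<Union>P\<in>peak_dirts (\<gamma> @ [a]). placements (sum_list \<gamma> + Suc a) P)"
    proof (cases rule: predirt_cases)
      case (new_row P)
      have "distinct (concat Q)"
        using pQ by (simp add: predirt_def standard_filling_iff)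
      \<comment> \<open>As a new row, \<open>Suc v\<close> would be in column 0 and hence not to the
        right of \<open>v\<close>.\<close>
      then show ?thesis
        using sQ column_eq[of Q 0 0] new_row(1) by (simp add: st)
    next
      case (place P r)
      then show ?thesis
        using key[OF place(1,2,4)] Q by (auto simp: placements_def v_def)
    qed
  next
    fix Q assume "Q \<in> (\<Union>P\<in>peak_dirts (\<gamma> @ [a]). placements (sum_list \<gamma> + Suc a) P)"
    then obtain P r where P: "P \<in> peak_dirts (\<gamma> @ [a])" "Q = P[r := P ! r @ [Suc v]]"
        "r < length P" "column P v < length (P ! r)"
        "\<not> (\<exists>r'<r. length (P ! r') = length (P ! r) + 1)"
      by (auto simp: placements_def v_def)
    moreover have "predirt v P" "P ! r \<noteq> []"
      using P(1,4) by (auto simp: peak_dirts_def v_def)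
    ultimately show "Q \<in> peak_dirts (\<gamma> @ [Suc a])"
      using key[of r P] by blast
  qed
qed

section \<open>The procedure as a whole\<close>

text \<open>A union over starting points passes through each step, a step being itself a union over
  its argument. Thus all fillings can be extended simultaneously.\<close>

lemma UN_foldl_UN:
  "(\<Union>x\<in>A. foldl (\<lambda>S v. \<Union>P\<in>S. f v P) {g x} vs) = foldl (\<lambda>S v. \<Union>P\<in>S. f v P) (g ` A) vs"
proof (induction vs rule: rev_induct)
  case (snoc v vs)
  show ?case
    by (simp flip: snoc.IH)
qed auto

lemma peak_dirts_extensions:
  assumes "\<forall>a\<in>set \<gamma>. 0 < a" "\<gamma> \<noteq> []" "2 \<le> a"
  shows "(\<Union>Q\<in>peak_dirts \<gamma>. extensions a Q) = peak_dirts (\<gamma> @ [a])"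
proof -
  define m where "m = sum_list \<gamma>"
  let ?f = "\<lambda>S v. \<Union>P\<in>S. placements v P"
  \<comment> \<open>Makes \<open>entries Q\<close> nonempty, so that \<open>Max\<close> is
    meaningful.\<close>
  have "0 < m"
    using assms by (cases \<gamma>) (auto simp: m_def)
  have Max: "Max (entries Q) = m" if "Q \<in> peak_dirts \<gamma>" for Q
  proof -
    have "entries Q = {1..m}"
      using that by (simp add: peak_dirts_def predirt_def standard_filling_def m_def)
    then show ?thesis using \<open>0 < m\<close> by (auto intro: Max_eqI)
  qed
  have "(\<Union>Q\<in>peak_dirts \<gamma>. extensions a Q) =
      (\<Union>Q\<in>peak_dirts \<gamma>. foldl ?f {[m + 1, m + 2] # Q} [m + 3..<m + a + 1])"
    unfolding extensions_def by (intro SUP_cong) (simp_all add: Max Let_def)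
  also have "\<dots> = foldl ?f (peak_dirts (\<gamma> @ [2])) [m + 3..<m + a + 1]"
    unfolding UN_foldl_UN using peak_dirts_new_row[OF assms(1,2)] by (simp add: m_def)
  also have "\<dots> = peak_dirts (\<gamma> @ [a])"
    using assms(3)
  \<comment> \<open>The induction starts at 2, where nothing remains to be placed after the new
    bottom row; each increase appends one value to the list and is an instance of
    \<open>peak_dirts_place\<close>.\<close>
  proof (induction a rule: dec_induct)
    case base
    then show ?case by simp
  next
    case (step b)
    then have "[m + 3..<m + Suc b + 1] = [m + 3..<m + b + 1] @ [m + Suc b]"
      by simp
    then show ?case
      using step peak_dirts_place[OF assms(1), of b] by (simp add: m_def del: upt_Suc)
  qed
  finally show ?thesis .
qed

text \<open>The procedure reads \<open>\<alpha>\<close> from its last part, so a part at the front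
  of \<open>\<alpha>\<close> becomes the last strip of \<open>rev \<alpha>\<close>, as in
  \<open>peak_dirts_extensions\<close>.\<close>

lemma generated_eq_peak_dirts:
  assumes "\<alpha> \<noteq> []" "\<forall>a\<in>set \<alpha>. 0 < a" "\<forall>a\<in>set (butlast \<alpha>). 1 < a"
  shows "generated \<alpha> = peak_dirts (rev \<alpha>)"
  using assms
proof (induction \<alpha> rule: generated.induct)
  case (3 a b \<alpha>)
  then have "generated (b # \<alpha>) = peak_dirts (rev (b # \<alpha>))"
    by (simp split: if_splits)
  then show ?case
    using peak_dirts_extensions[of "rev (b # \<alpha>)" a] 3 by simp
qed (simp_all add: peak_dirts_singleton)

theorem proposition4p18:
  fixes n :: nat and \<alpha> :: "nat list"
  assumes "0 < n" and "peak_composition n \<alpha>"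
  shows "generated \<alpha> =
    {Q. dirt n Q \<and> peak_composition n (shape Q) \<and> has_row_strip_shape n Q (rev \<alpha>)}"
proof -
  have "composition n (rev \<alpha>)" "\<alpha> \<noteq> []"
    using assms by (auto simp: peak_composition_def composition_def)
  then show ?thesis
    using generated_eq_peak_dirts[of \<alpha>] peak_dirts_eq[of n "rev \<alpha>"] assms(2)
    by (auto simp: peak_composition_def composition_def)
qed

end
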